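(* Let $\mathcal I$ be a proper ideal on $\mathbb N$ and let $k$ be a positive integer. Then $\dim(\ell_\infty/c_{0,\mathcal I})=k$ if and only if $\mathcal I$ is the intersection of exactly $k$ (pairwise distinct) maximal ideals on $\mathbb N$.
   Context: An ideal on $\mathbb N$ is a family of subsets of $\mathbb N$ containing $\emptyset$ and closed under subsets and finite unions; every ideal is assumed to contain all finite sets, and it is proper if it is not $\mathcal P(\mathbb N)$. A maximal ideal is a proper ideal whose only proper extension is $\mathcal P(\mathbb N)$. $\ell_\infty$ is the real Banach lattice of bounded real sequences, and $c_{0,\mathcal I}$ is the closed subspace of all $(x_n)\in\ell_\infty$ with $\{n:|x_n|\ge\varepsilon\}\in\mathcal I$ for every $\varepsilon>0$. *)

theory Defs
  imports
    "HOL-Algebra.AbelCoset"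
    "HOL-Analysis.Bounded_Continuous_Function"
    "Jordan_Normal_Form.VS_Connect"
begin

hide_const (open) Multiset.mult Polynomial.smult

definition nat_ideal :: "nat set set \<Rightarrow> bool" where
  "nat_ideal I \<longleftrightarrow>
     {} \<in> I \<and>
     (\<forall>A B. A \<in> I \<and> B \<subseteq> A \<longrightarrow> B \<in> I) \<and>
     (\<forall>A B. A \<in> I \<and> B \<in> I \<longrightarrow> A \<union> B \<in> I) \<and>
     (\<forall>A. finite A \<longrightarrow> A \<in> I)"

definition proper_nat_ideal :: "nat set set \<Rightarrow> bool" where
  "proper_nat_ideal I \<longleftrightarrow> nat_ideal I \<and> I \<noteq> Pow UNIV"

definition maximal_nat_ideal :: "nat set set \<Rightarrow> bool" where
  "maximal_nat_ideal I \<longleftrightarrow>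
     proper_nat_ideal I \<and> (\<forall>J. nat_ideal J \<and> I \<subset> J \<longrightarrow> J = Pow UNIV)"

text \<open>The type \<^typ>\<open>nat\<close> carries the discrete topology, so every sequence is continuous and the
  bounded continuous functions on it are exactly the bounded sequences.\<close>

type_synonym linf = "nat \<Rightarrow>\<^sub>C real"

definition c0_ideal :: "nat set set \<Rightarrow> linf set" where
  "c0_ideal I = {x. \<forall>\<epsilon>>0. {n. \<epsilon> \<le> \<bar>apply_bcontfun x n\<bar>} \<in> I}"

text \<open>The ring components \<^const>\<open>mult\<close> and \<^const>\<open>one\<close> of a module record are irrelevant.\<close>

definition real_vs :: "(real, 'a::real_vector) module" where
  "real_vs = \<lparr>carrier = UNIV, mult = undefined, one = undefined, zero = 0, add = (+),
     smult = scaleR\<rparr>"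

text \<open>Since \<open>0 \<cdot> X = {0}\<close> is in general not a coset, the pointwise multiple \<open>a \<cdot> X\<close> is
  saturated by adding \<open>W\<close>; this gives \<open>a \<cdot> (x + W) = a \<cdot> x + W\<close> for every \<open>a\<close>.\<close>

definition quotient_vs :: "('k, 'a) module \<Rightarrow> 'a set \<Rightarrow> ('k, 'a set) module" where
  "quotient_vs V W = \<lparr>carrier = A_RCOSETS V W, mult = undefined, one = undefined,
     zero = W, add = set_add V, smult = (\<lambda>a X. set_add V W ((\<lambda>x. a \<odot>\<^bsub>V\<^esub> x) ` X))\<rparr>"

lemma apply_bcontfun_Bcontfun_nat:
  fixes f :: "nat \<Rightarrow> real"
  assumes "bounded (range f)"
  shows "apply_bcontfun (Bcontfun f) = f"
  using assms by (intro Bcontfun_inverse) (auto simp: bcontfun_def)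

lemma subspace_c0_ideal:
  assumes "nat_ideal I"
  shows "Real_Vector_Spaces.subspace (c0_ideal I)"
  unfolding Real_Vector_Spaces.subspace_def
proof (intro conjI ballI allI)
  have sub: "\<And>A B. A \<in> I \<Longrightarrow> B \<subseteq> A \<Longrightarrow> B \<in> I" and un: "\<And>A B. A \<in> I \<Longrightarrow> B \<in> I \<Longrightarrow> A \<union> B \<in> I"
    and em: "{} \<in> I"
    using assms by (auto simp: nat_ideal_def)
  show zero: "0 \<in> c0_ideal I"
    using em by (auto simp: c0_ideal_def)
  fix x y assume x: "x \<in> c0_ideal I"
  show "c *\<^sub>R x \<in> c0_ideal I" for c
  proof (cases "c = 0")
    case False
    have "{n. e \<le> \<bar>c * apply_bcontfun x n\<bar>} \<in> I" if "e > 0" for e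
    proof -
      have "{n. e / \<bar>c\<bar> \<le> \<bar>apply_bcontfun x n\<bar>} \<in> I"
        using x that False by (auto simp: c0_ideal_def)
      then show ?thesis
        using False by (simp add: abs_mult field_simps)
    qed
    then show ?thesis
      by (simp add: c0_ideal_def)
  qed (use zero in simp)
  assume y: "y \<in> c0_ideal I"
  have "{n. e \<le> \<bar>apply_bcontfun x n + apply_bcontfun y n\<bar>} \<in> I" if "e > 0" for e
  proof (rule sub)
    have "e / 2 > 0"
      using that by simp
    then show "{n. e / 2 \<le> \<bar>apply_bcontfun x n\<bar>} \<union> {n. e / 2 \<le> \<bar>apply_bcontfun y n\<bar>} \<in> I"
      using x y unfolding c0_ideal_def by (intro un) blast+
  qed auto
  then show "x + y \<in> c0_ideal I"
    by (simp add: c0_ideal_def)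
qed

lemma real_quotient_vs_simps:
  fixes W :: "'a::real_vector set"
  assumes "Real_Vector_Spaces.subspace W"
  shows "carrier (quotient_vs real_vs W) = range (\<lambda>x. (+) x ` W)"
    and "\<zero>\<^bsub>quotient_vs real_vs W\<^esub> = (+) 0 ` W"
    and "(+) x ` W \<oplus>\<^bsub>quotient_vs real_vs W\<^esub> (+) y ` W = (+) (x + y) ` W"
    and "a \<odot>\<^bsub>quotient_vs real_vs W\<^esub> (+) x ` W = (+) (a *\<^sub>R x) ` W"
proof -
  note W = subspace_0[OF assms] subspace_add[OF assms] subspace_scale[OF assms]
  show "carrier (quotient_vs real_vs W) = range (\<lambda>x. (+) x ` W)"
    by (auto simp: quotient_vs_def real_vs_def A_RCOSETS_def' a_r_coset_def' image_iff add.commute)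
  show "\<zero>\<^bsub>quotient_vs real_vs W\<^esub> = (+) 0 ` W"
    by (auto simp: quotient_vs_def)
  show "(+) x ` W \<oplus>\<^bsub>quotient_vs real_vs W\<^esub> (+) y ` W = (+) (x + y) ` W"
  proof (rule Set.set_eqI, rule iffI)
    fix z assume "z \<in> (+) x ` W \<oplus>\<^bsub>quotient_vs real_vs W\<^esub> (+) y ` W"
    then obtain u v where "u \<in> W" "v \<in> W" "z = (x + u) + (y + v)"
      by (auto simp: quotient_vs_def real_vs_def set_add_def')
    then show "z \<in> (+) (x + y) ` W"
      by (intro image_eqI[of _ _ "u + v"]) (auto intro: W)
  next
    fix z assume "z \<in> (+) (x + y) ` W"
    then obtain u where "u \<in> W" "z = (x + u) + (y + 0)"
      by auto
    then show "z \<in> (+) x ` W \<oplus>\<^bsub>quotient_vs real_vs W\<^esub> (+) y ` W"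
      using W(1) by (force simp: quotient_vs_def real_vs_def set_add_def')
  qed
  show "a \<odot>\<^bsub>quotient_vs real_vs W\<^esub> (+) x ` W = (+) (a *\<^sub>R x) ` W"
  proof (rule Set.set_eqI, rule iffI)
    fix z assume "z \<in> a \<odot>\<^bsub>quotient_vs real_vs W\<^esub> (+) x ` W"
    then obtain u v where "u \<in> W" "v \<in> W" "z = u + a *\<^sub>R (x + v)"
      by (auto simp: quotient_vs_def real_vs_def set_add_def')
    then show "z \<in> (+) (a *\<^sub>R x) ` W"
      by (intro image_eqI[of _ _ "u + a *\<^sub>R v"]) (auto intro: W simp: algebra_simps)
  next
    fix z assume "z \<in> (+) (a *\<^sub>R x) ` W"
    then obtain u where "u \<in> W" "z = u + a *\<^sub>R (x + 0)"
      by auto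
    then show "z \<in> a \<odot>\<^bsub>quotient_vs real_vs W\<^esub> (+) x ` W"
      using W(1) by (force simp: quotient_vs_def real_vs_def set_add_def')
  qed
qed

lemma vectorspace_real_quotient_vs:
  fixes W :: "'a::real_vector set"
  assumes "Real_Vector_Spaces.subspace W"
  shows "vectorspace class_ring (quotient_vs real_vs W)"
proof -
  define C where "C x = (+) x ` W" for x
  note [simp] = real_quotient_vs_simps[OF assms, folded C_def]
  have "abelian_group (quotient_vs real_vs W)"
  proof (rule abelian_groupI)
    fix X assume "X \<in> carrier (quotient_vs real_vs W)"
    then obtain x where "X = C x" by auto
    then show "\<exists>Y\<in>carrier (quotient_vs real_vs W).
        Y \<oplus>\<^bsub>quotient_vs real_vs W\<^esub> X = \<zero>\<^bsub>quotient_vs real_vs W\<^esub>"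
      by (intro bexI[of _ "C (- x)"]) auto
  qed (auto simp: add_ac)
  then have "module (class_ring :: real ring) (quotient_vs real_vs W)"
    by (intro moduleI class_cring.is_cring) (auto simp: algebra_simps)
  then show ?thesis
    by (simp add: vectorspace_def class_field)
qed

end

theory Submission
  imports Defs
begin

text \<open>
  Both directions rest on indicator sequences. An indicator \<open>1\<^sub>A\<close> vanishes in
  \<open>\<ell>\<^sub>\<infinity>/c\<^sub>0(I)\<close> exactly when \<open>A \<in> I\<close>, so sets outside \<open>I\<close> supply nonzero vectors of the quotient.

  Suppose that \<open>I\<close> is the intersection of a finite set \<open>M\<close> of maximal ideals. Each \<open>J \<in> M\<close> is dual to
  an ultrafilter, so every bounded sequence \<open>x\<close> has a limit \<open>L\<^sub>J(x)\<close> along \<open>J\<close>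
  (\<open>maximal_ideal_limit\<close>). Finitely many maximal ideals can be separated: there are sets \<open>A\<^sub>J\<close> that
  belong to every member of \<open>M\<close> other than \<open>J\<close>, but not to \<open>J\<close> (\<open>maximal_ideals_separated\<close>). The
  \<open>J'\<close>-limit of \<open>1\<^bsub>A\<^sub>J\<^esub>\<close> is then \<open>1\<close> if \<open>J' = J\<close> and \<open>0\<close> otherwise, and
  \<open>x - \<Sum>\<^sub>J L\<^sub>J(x) 1\<^bsub>A\<^sub>J\<^esub>\<close> tends to \<open>0\<close> along every member of \<open>M\<close>, that is, along \<open>I\<close>. Hence the
  classes of these indicators are a basis, and the dimension is \<open>card M\<close>.

  Suppose conversely that the quotient has finite dimension. Disjoint sets outside \<open>I\<close> have
  independent indicators, so the size of a disjoint family of such sets is bounded by the dimension.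
  Take a family \<open>F\<close> of greatest size. No \<open>A \<in> F\<close> splits into two sets outside \<open>I\<close>, since this would
  enlarge \<open>F\<close>; hence the sets that meet \<open>A\<close> in a member of \<open>I\<close> form a maximal ideal. For the same
  reason the complement of \<open>\<Union>F\<close> is in \<open>I\<close>, and so \<open>I\<close> is the intersection of these ideals
  (\<open>Inter_maximal_if_bounded\<close>). That their number is the dimension follows from the first direction.
\<close>

section \<open>Bases of a quotient space\<close>

context
  fixes W :: "'a::real_vector set"
  assumes W: "Real_Vector_Spaces.subspace W"
begin

lemma coset_eq_iff: "(+) x ` W = (+) y ` W \<longleftrightarrow> x - y \<in> W"
proof
  assume "(+) x ` W = (+) y ` W"
  moreover have "x \<in> (+) x ` W"
    using Real_Vector_Spaces.subspace_0[OF W] by force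
  ultimately show "x - y \<in> W"
    by auto
next
  assume d: "x - y \<in> W"
  have "(+) u ` W \<subseteq> (+) v ` W" if "u - v \<in> W" for u v
  proof
    fix z assume "z \<in> (+) u ` W"
    then obtain w where "w \<in> W" "z = v + ((u - v) + w)"
      by auto
    then show "z \<in> (+) v ` W"
      using Real_Vector_Spaces.subspace_add[OF W that] by blast
  qed
  moreover have "y - x \<in> W"
    using Real_Vector_Spaces.subspace_neg[OF W d] by simp
  ultimately show "(+) x ` W = (+) y ` W"
    using d by blast
qed

lemma finsum_quotient_vs:
  assumes "finite S"
  shows "finsum (quotient_vs real_vs W) (\<lambda>i. (+) (f i) ` W) S = (+) (sum f S) ` W"
proof -
  interpret vectorspace class_ring "quotient_vs real_vs W"
    using W by (rule vectorspace_real_quotient_vs)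
  show ?thesis
    using assms
  proof (induction S)
    case empty
    show ?case
      using real_quotient_vs_simps(2)[OF W] by simp
  next
    case (insert i S)
    then show ?case
      by (simp add: real_quotient_vs_simps[OF W] Pi_def)
  qed
qed

text \<open>Independence and spanning modulo \<open>W\<close> are stated for an indexed family of representatives, so
  that cosets do not appear outside this section. Independence makes the representatives pairwise
  incongruent, so the number of cosets is the number of indices.\<close>

context
  fixes S :: "'i set" and b :: "'i \<Rightarrow> 'a"
  assumes finite_S: "finite S"
    and indep: "\<And>c i. (\<Sum>i\<in>S. c i *\<^sub>R b i) \<in> W \<Longrightarrow> i \<in> S \<Longrightarrow> c i = 0"
begin

lemma inj_on_coset: "inj_on (\<lambda>i. (+) (b i) ` W) S"
proof (rule inj_onI, rule ccontr)
  fix i j assume ij: "i \<in> S" "j \<in> S" "i \<noteq> j" and "(+) (b i) ` W = (+) (b j) ` W"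
  then have d: "b i - b j \<in> W"
    by (simp add: coset_eq_iff)
  define c :: "'i \<Rightarrow> real" where "c l = (if l = i then 1 else 0) - (if l = j then 1 else 0)" for l
  have "(\<Sum>l\<in>S. c l *\<^sub>R b l) = (\<Sum>l\<in>S. if l = i then b l else 0) - (\<Sum>l\<in>S. if l = j then b l else 0)"
    unfolding sum_subtractf[symmetric] by (rule sum.cong) (auto simp: c_def)
  also have "\<dots> = b i - b j"
    using ij finite_S by simp
  finally have "c i = 0"
    using d ij by (intro indep) simp_all
  then show False
    using ij by (simp add: c_def)
qed

lemma lincomb_cosets:
  "module.lincomb (quotient_vs real_vs W) a ((\<lambda>i. (+) (b i) ` W) ` S)
     = (+) (\<Sum>i\<in>S. a ((+) (b i) ` W) *\<^sub>R b i) ` W"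
proof -
  interpret vectorspace class_ring "quotient_vs real_vs W"
    using W by (rule vectorspace_real_quotient_vs)
  have "lincomb a ((\<lambda>i. (+) (b i) ` W) ` S) =
      finsum (quotient_vs real_vs W)
        (\<lambda>i. a ((+) (b i) ` W) \<odot>\<^bsub>quotient_vs real_vs W\<^esub> (+) (b i) ` W) S"
    unfolding lincomb_def
    by (rule finsum_reindex[OF _ inj_on_coset])
       (auto simp: real_quotient_vs_simps[OF W])
  also have "\<dots> = (+) (\<Sum>i\<in>S. a ((+) (b i) ` W) *\<^sub>R b i) ` W"
    unfolding real_quotient_vs_simps(4)[OF W] by (rule finsum_quotient_vs[OF finite_S])
  finally show ?thesis .
qed

lemma lin_indpt_cosets:
  "\<not> module.lin_dep class_ring (quotient_vs real_vs W) ((\<lambda>i. (+) (b i) ` W) ` S)"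
proof -
  interpret vectorspace class_ring "quotient_vs real_vs W"
    using W by (rule vectorspace_real_quotient_vs)
  show ?thesis
  proof (rule finite_lin_indpt2)
    show "finite ((\<lambda>i. (+) (b i) ` W) ` S)"
      using finite_S by (rule finite_imageI)
    show "(\<lambda>i. (+) (b i) ` W) ` S \<subseteq> carrier (quotient_vs real_vs W)"
      by (auto simp: real_quotient_vs_simps[OF W])
    fix a :: "'a set \<Rightarrow> real"
    assume "lincomb a ((\<lambda>i. (+) (b i) ` W) ` S) = \<zero>\<^bsub>quotient_vs real_vs W\<^esub>"
    then have "(\<Sum>i\<in>S. a ((+) (b i) ` W) *\<^sub>R b i) \<in> W"
      unfolding lincomb_cosets real_quotient_vs_simps(2)[OF W] coset_eq_iff by simp
    from indep[OF this] show "\<forall>v\<in>(\<lambda>i. (+) (b i) ` W) ` S. a v = \<zero>\<^bsub>class_ring\<^esub>"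
      by auto
  qed
qed

lemma card_le_dim_quotient:
  assumes "vectorspace.fin_dim (class_ring :: real ring) (quotient_vs real_vs W)"
  shows "card S \<le> vectorspace.dim (class_ring :: real ring) (quotient_vs real_vs W)"
proof -
  interpret vectorspace class_ring "quotient_vs real_vs W"
    using W by (rule vectorspace_real_quotient_vs)
  have "card ((\<lambda>i. (+) (b i) ` W) ` S) \<le> dim"
    using assms lin_indpt_cosets
    by (intro li_le_dim) (auto simp: real_quotient_vs_simps[OF W])
  then show ?thesis
    by (simp add: card_image[OF inj_on_coset])
qed

lemma dim_quotient_eq_card:
  assumes spanning: "\<And>x. \<exists>c. x - (\<Sum>i\<in>S. c i *\<^sub>R b i) \<in> W"
  shows "vectorspace.fin_dim (class_ring :: real ring) (quotient_vs real_vs W)"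
    and "vectorspace.dim (class_ring :: real ring) (quotient_vs real_vs W) = card S"
proof -
  interpret vectorspace class_ring "quotient_vs real_vs W"
    using W by (rule vectorspace_real_quotient_vs)
  define B where "B = (\<lambda>i. (+) (b i) ` W) ` S"
  have BV: "B \<subseteq> carrier (quotient_vs real_vs W)"
    by (auto simp: B_def real_quotient_vs_simps[OF W])
  have finB: "finite B"
    unfolding B_def using finite_S by (rule finite_imageI)
  have "X \<in> span B" if X: "X \<in> carrier (quotient_vs real_vs W)" for X
  proof -
    obtain x where x: "X = (+) x ` W"
      using X by (auto simp: real_quotient_vs_simps[OF W])
    obtain c where c: "x - (\<Sum>i\<in>S. c i *\<^sub>R b i) \<in> W"
      using spanning by blast
    \<comment> \<open>A linear combination takes its coefficients from the cosets, so each coset has to be traced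
      back to its index.\<close>
    define a where "a v = c (inv_into S (\<lambda>i. (+) (b i) ` W) v)" for v
    have "a ((+) (b i) ` W) = c i" if "i \<in> S" for i
      using inv_into_f_f[OF inj_on_coset that] by (simp add: a_def)
    then have "(\<Sum>i\<in>S. a ((+) (b i) ` W) *\<^sub>R b i) = (\<Sum>i\<in>S. c i *\<^sub>R b i)"
      by (intro sum.cong) simp_all
    with c x have "X = lincomb a B"
      unfolding B_def lincomb_cosets by (simp add: coset_eq_iff)
    then show ?thesis
      using finB unfolding span_def by auto
  qed
  moreover have "span B \<subseteq> carrier (quotient_vs real_vs W)"
    using BV by (rule span_is_subset2)
  ultimately have gen: "span B = carrier (quotient_vs real_vs W)"
    by blast
  show fin_dim
    unfolding fin_dim_def using finB BV gen by blast
  have "basis B"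
    using gen BV lin_indpt_cosets unfolding basis_def B_def by blast
  then show "dim = card S"
    using dim_basis[OF finB] card_image[OF inj_on_coset] by (simp add: B_def)
qed

end

end

section \<open>Ideals and maximal ideals\<close>

lemma nat_idealD:
  assumes "nat_ideal I"
  shows ideal_empty: "{} \<in> I"
    and ideal_subset: "\<And>A B. A \<in> I \<Longrightarrow> B \<subseteq> A \<Longrightarrow> B \<in> I"
    and ideal_Un: "\<And>A B. A \<in> I \<Longrightarrow> B \<in> I \<Longrightarrow> A \<union> B \<in> I"
    and ideal_finite: "\<And>A. finite A \<Longrightarrow> A \<in> I"
  using assms unfolding nat_ideal_def by blast+

lemma nat_idealI:
  assumes "{} \<in> I" and "\<And>A B. A \<in> I \<Longrightarrow> B \<subseteq> A \<Longrightarrow> B \<in> I"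
    and "\<And>A B. A \<in> I \<Longrightarrow> B \<in> I \<Longrightarrow> A \<union> B \<in> I" and "\<And>A. finite A \<Longrightarrow> A \<in> I"
  shows "nat_ideal I"
  unfolding nat_ideal_def by (meson assms)

lemma nat_ideal_trace:
  assumes I: "nat_ideal I"
  shows "nat_ideal {B. B \<inter> A \<in> I}"
proof (rule nat_idealI)
  show "C \<in> {B. B \<inter> A \<in> I}" if "B \<in> {B. B \<inter> A \<in> I}" "C \<subseteq> B" for B C
    using that ideal_subset[OF I, of "B \<inter> A" "C \<inter> A"] by auto
qed (simp_all add: ideal_empty[OF I] ideal_Un[OF I] ideal_finite[OF I] Int_Un_distrib2)

lemma ideal_UN:
  assumes I: "nat_ideal I" and "finite S" and "\<And>i. i \<in> S \<Longrightarrow> A i \<in> I"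
  shows "(\<Union>i\<in>S. A i) \<in> I"
  using assms(2,3) by (induction S) (auto intro: ideal_empty[OF I] ideal_Un[OF I])

lemma maximal_ideal_is_ideal: "maximal_nat_ideal J \<Longrightarrow> nat_ideal J"
  unfolding maximal_nat_ideal_def proper_nat_ideal_def by blast

lemma maximal_ideal_UNIV:
  assumes "maximal_nat_ideal J"
  shows "UNIV \<notin> J"
proof
  assume "UNIV \<in> J"
  then have "B \<in> J" for B
    using ideal_subset[OF maximal_ideal_is_ideal[OF assms] _ subset_UNIV] by simp
  then show False
    using assms unfolding maximal_nat_ideal_def proper_nat_ideal_def by auto
qed

text \<open>Maximal ideals are prime: \<open>J\<close> and a set \<open>A \<notin> J\<close> together generate the ideal of all \<open>B\<close> with
  \<open>B \<inter> - A \<in> J\<close>, and by maximality this ideal contains the whole of \<open>\<nat>\<close>.\<close>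

lemma maximal_ideal_Compl:
  assumes J: "maximal_nat_ideal J" and A: "A \<notin> J"
  shows "- A \<in> J"
proof -
  note I = maximal_ideal_is_ideal[OF J]
  define J' where "J' = {B. B \<inter> - A \<in> J}"
  have "nat_ideal J'"
    unfolding J'_def by (rule nat_ideal_trace[OF I])
  moreover have "J \<subset> J'"
  proof
    show "J \<subseteq> J'"
      unfolding J'_def by (intro subsetI CollectI) (rule ideal_subset[OF I _ Int_lower1])
    have "A \<in> J'"
      using ideal_empty[OF I] by (simp add: J'_def)
    then show "J \<noteq> J'"
      using A by blast
  qed
  ultimately have "UNIV \<in> J'"
    using J unfolding maximal_nat_ideal_def by blast
  then show ?thesis
    by (simp add: J'_def)
qed

lemma maximal_nat_idealI:
  assumes J: "nat_ideal J" and "UNIV \<notin> J" and prime: "\<And>B. B \<notin> J \<Longrightarrow> - B \<in> J"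
  shows "maximal_nat_ideal J"
  unfolding maximal_nat_ideal_def proper_nat_ideal_def
proof (intro conjI allI impI)
  fix K assume K: "nat_ideal K \<and> J \<subset> K"
  then obtain B where "B \<in> K" "- B \<in> K"
    using prime by blast
  then have "B \<union> - B \<in> K"
    using K by (blast intro: ideal_Un)
  then show "K = Pow UNIV"
    using K by (auto intro: ideal_subset)
qed (use assms in auto)

text \<open>The separating set is an intersection of sets that separate \<open>J\<close> from one other ideal at a
  time; by primality of \<open>J\<close>, a finite intersection of sets outside \<open>J\<close> stays outside \<open>J\<close>.\<close>

lemma maximal_ideals_separated:
  assumes M: "finite M" "\<And>J. J \<in> M \<Longrightarrow> maximal_nat_ideal J" and J: "J \<in> M"
  shows "\<exists>A. A \<notin> J \<and> (\<forall>K\<in>M - {J}. A \<in> K)"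
proof -
  note maxJ = M(2)[OF J]
  have "\<exists>A. A \<in> K \<and> A \<notin> J" if K: "K \<in> M - {J}" for K
  proof (rule ccontr)
    assume "\<not> ?thesis"
    with K have "K \<subset> J" and "maximal_nat_ideal K"
      using M(2) by auto
    with maxJ show False
      unfolding maximal_nat_ideal_def proper_nat_ideal_def by blast
  qed
  then obtain A where A: "\<And>K. K \<in> M - {J} \<Longrightarrow> A K \<in> K \<and> A K \<notin> J"
    by metis
  have compl: "(\<Union>K\<in>M - {J}. - A K) \<in> J"
    using M(1) A
    by (intro ideal_UN maximal_ideal_is_ideal[OF maxJ]) (auto intro: maximal_ideal_Compl[OF maxJ])
  have "(\<Inter>K\<in>M - {J}. A K) \<notin> J"
  proof
    assume "(\<Inter>K\<in>M - {J}. A K) \<in> J"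
    from ideal_Un[OF maximal_ideal_is_ideal[OF maxJ] this compl]
    have "(\<Inter>K\<in>M - {J}. A K) \<union> (\<Union>K\<in>M - {J}. - A K) \<in> J" .
    also have "(\<Inter>K\<in>M - {J}. A K) \<union> (\<Union>K\<in>M - {J}. - A K) = UNIV"
      by blast
    finally show False
      using maximal_ideal_UNIV[OF maxJ] by simp
  qed
  moreover have "(\<Inter>K\<in>M - {J}. A K) \<in> K" if "K \<in> M - {J}" for K
  proof (rule ideal_subset)
    show "nat_ideal K" and "A K \<in> K"
      using that A M(2) maximal_ideal_is_ideal by auto
  qed (use that in blast)
  ultimately show ?thesis
    by blast
qed

section \<open>Indicator sequences and limits along an ideal\<close>

definition ind :: "nat set \<Rightarrow> linf" where
  "ind A = Bcontfun (indicator A)"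

lemma apply_ind: "apply_bcontfun (ind A) = indicator A"
proof -
  have "range (indicator A :: nat \<Rightarrow> real) \<subseteq> {0, 1}"
    by (auto simp: indicator_def)
  then have "bounded (range (indicator A :: nat \<Rightarrow> real))"
    by (rule bounded_subset[rotated]) simp
  then show ?thesis
    unfolding ind_def by (rule apply_bcontfun_Bcontfun_nat)
qed

lemma apply_bcontfun_sum: "apply_bcontfun (sum f S) n = (\<Sum>i\<in>S. apply_bcontfun (f i) n)"
  by (induction S rule: infinite_finite_induct) simp_all

lemma ind_add_Compl: "ind A + ind (- A) = ind UNIV"
  by (rule bcontfun_eqI) (simp add: apply_ind indicator_def)

lemma ind_in_c0_ideal_iff:
  assumes I: "nat_ideal I"
  shows "ind A \<in> c0_ideal I \<longleftrightarrow> A \<in> I"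
proof
  assume "ind A \<in> c0_ideal I"
  then have "\<forall>\<epsilon>>0. {n. \<epsilon> \<le> \<bar>indicator A n :: real\<bar>} \<in> I"
    unfolding c0_ideal_def mem_Collect_eq apply_ind .
  from this[rule_format, of 1]
  have "{n. 1 \<le> \<bar>indicator A n :: real\<bar>} \<in> I"
    by simp
  also have "{n. 1 \<le> \<bar>indicator A n :: real\<bar>} = A"
    by (auto simp: indicator_def)
  finally show "A \<in> I" .
next
  assume A: "A \<in> I"
  have "{n. \<epsilon> \<le> \<bar>indicator A n :: real\<bar>} \<in> I" if "\<epsilon> > 0" for \<epsilon>
    by (rule ideal_subset[OF I A]) (use that in \<open>auto simp: indicator_def\<close>)
  then show "ind A \<in> c0_ideal I"
    by (simp add: c0_ideal_def apply_ind)
qed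

lemma c0_ideal_Inter: "x \<in> c0_ideal (\<Inter>M) \<longleftrightarrow> (\<forall>J\<in>M. x \<in> c0_ideal J)"
  by (auto simp: c0_ideal_def)

text \<open>The limit is the supremum \<open>L\<close> of the levels below which \<open>x\<close> stays only on a set in \<open>J\<close>. Above
  \<open>L\<close> no level has this property, and primality of \<open>J\<close> turns that into \<open>x < L + \<epsilon>\<close> off a set in
  \<open>J\<close>.\<close>

lemma maximal_ideal_limit:
  assumes J: "maximal_nat_ideal J"
  shows "\<exists>L. x - L *\<^sub>R ind UNIV \<in> c0_ideal J"
proof -
  note I = maximal_ideal_is_ideal[OF J]
  have "\<bar>apply_bcontfun x n\<bar> \<le> norm x" for n
    using norm_bounded[of x n] by simp
  then have lower: "- norm x \<le> apply_bcontfun x n" and upper: "apply_bcontfun x n \<le> norm x" for n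
    by (simp_all add: abs_le_iff minus_le_iff)
  define S where "S = {c. {n. apply_bcontfun x n < c} \<in> J}"
  have "- norm x \<in> S"
  proof -
    have "{n. apply_bcontfun x n < - norm x} = {}"
      using lower by (simp add: not_less)
    then show ?thesis
      by (simp add: S_def ideal_empty[OF I])
  qed
  then have ne: "S \<noteq> {}"
    by blast
  have "c \<le> norm x" if "c \<in> S" for c
  proof (rule ccontr)
    assume "\<not> c \<le> norm x"
    then have "{n. apply_bcontfun x n < c} = UNIV"
      by (auto intro: le_less_trans[OF upper])
    then show False
      using that maximal_ideal_UNIV[OF J] by (simp add: S_def)
  qed
  then have bdd: "bdd_above S"
    by (rule bdd_aboveI)
  have "{n. \<epsilon> \<le> \<bar>apply_bcontfun x n - Sup S\<bar>} \<in> J" if \<epsilon>: "\<epsilon> > 0" for \<epsilon>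
  proof -
    obtain c where c: "c \<in> S" "Sup S - \<epsilon> < c"
      using less_cSup_iff[OF ne bdd, of "Sup S - \<epsilon>"] \<epsilon> by auto
    \<comment> \<open>The strict lower bound \<open>c > L - \<epsilon>\<close> also covers the indices with \<open>x = L - \<epsilon>\<close>.\<close>
    have low: "{n. apply_bcontfun x n < c} \<in> J"
      using c by (simp add: S_def)
    have "Sup S + \<epsilon> \<notin> S"
      using cSup_upper[OF _ bdd, of "Sup S + \<epsilon>"] \<epsilon> by auto
    then have up: "- {n. apply_bcontfun x n < Sup S + \<epsilon>} \<in> J"
      by (intro maximal_ideal_Compl[OF J]) (simp add: S_def)
    show ?thesis
      by (rule ideal_subset[OF I ideal_Un[OF I low up]]) (use c in auto)
  qed
  then have "x - Sup S *\<^sub>R ind UNIV \<in> c0_ideal J"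
    by (simp add: c0_ideal_def apply_ind)
  then show ?thesis ..
qed

section \<open>Finite intersections of maximal ideals\<close>

lemma nat_ideal_Inter:
  assumes "\<And>J. J \<in> M \<Longrightarrow> nat_ideal J"
  shows "nat_ideal (\<Inter>M)"
proof (rule nat_idealI)
  show "B \<in> \<Inter>M" if "A \<in> \<Inter>M" "B \<subseteq> A" for A B
    using that ideal_subset[OF assms] by (meson Inter_iff)
qed (use assms in \<open>simp_all add: ideal_empty ideal_Un ideal_finite\<close>)

text \<open>The indicators of separating sets are dual to the limits along the members of \<open>M\<close>.\<close>

proposition dim_quotient_Inter_maximal:
  assumes M: "finite M" "\<And>J. J \<in> M \<Longrightarrow> maximal_nat_ideal J"
  shows "vectorspace.fin_dim (class_ring :: real ring) (quotient_vs real_vs (c0_ideal (\<Inter>M)))"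
    and "vectorspace.dim (class_ring :: real ring) (quotient_vs real_vs (c0_ideal (\<Inter>M))) = card M"
proof -
  obtain A where A: "\<And>J. J \<in> M \<Longrightarrow> A J \<notin> J"
      "\<And>J K. J \<in> M \<Longrightarrow> K \<in> M \<Longrightarrow> K \<noteq> J \<Longrightarrow> A J \<in> K"
    using maximal_ideals_separated[OF M] by (metis DiffI singletonD)
  have idl: "nat_ideal K" if "K \<in> M" for K
    using that M(2) maximal_ideal_is_ideal by blast
  have sub: "Real_Vector_Spaces.subspace (c0_ideal K)" if "K \<in> M" for K
    by (intro subspace_c0_ideal idl that)
  have others: "(\<Sum>J\<in>M - {K}. c J *\<^sub>R ind (A J)) \<in> c0_ideal K" if "K \<in> M" for c K
  proof (rule Real_Vector_Spaces.subspace_sum[OF sub[OF that]])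
    fix J assume "J \<in> M - {K}"
    then have "ind (A J) \<in> c0_ideal K"
      using A(2) that ind_in_c0_ideal_iff[OF idl[OF that]] by auto
    then show "c J *\<^sub>R ind (A J) \<in> c0_ideal K"
      by (rule Real_Vector_Spaces.subspace_scale[OF sub[OF that]])
  qed
  have W: "Real_Vector_Spaces.subspace (c0_ideal (\<Inter>M))"
    by (intro subspace_c0_ideal nat_ideal_Inter idl)
  have indep: "c K = 0"
    if c: "(\<Sum>J\<in>M. c J *\<^sub>R ind (A J)) \<in> c0_ideal (\<Inter>M)" and K: "K \<in> M" for c K
  proof (rule ccontr)
    assume nz: "c K \<noteq> 0"
    have "(\<Sum>J\<in>M. c J *\<^sub>R ind (A J)) \<in> c0_ideal K"
      using c K by (simp add: c0_ideal_Inter)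
    from Real_Vector_Spaces.subspace_diff[OF sub[OF K] this others[OF K, of c]]
    have "c K *\<^sub>R ind (A K) \<in> c0_ideal K"
      by (simp add: sum.remove[OF M(1) K])
    from Real_Vector_Spaces.subspace_scale[OF sub[OF K] this, of "1 / c K"]
    have "ind (A K) \<in> c0_ideal K"
      using nz by simp
    then show False
      using A(1)[OF K] by (simp add: ind_in_c0_ideal_iff[OF idl[OF K]])
  qed
  have spanning: "\<exists>c. x - (\<Sum>J\<in>M. c J *\<^sub>R ind (A J)) \<in> c0_ideal (\<Inter>M)" for x
  proof -
    obtain L where L: "\<And>J. J \<in> M \<Longrightarrow> x - L J *\<^sub>R ind UNIV \<in> c0_ideal J"
      using maximal_ideal_limit[where x = x, OF M(2)] by metis
    have "x - (\<Sum>J\<in>M. L J *\<^sub>R ind (A J)) \<in> c0_ideal K" if K: "K \<in> M" for K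
    proof -
      have eq: "x - (\<Sum>J\<in>M. L J *\<^sub>R ind (A J)) = (x - L K *\<^sub>R ind UNIV)
          + L K *\<^sub>R ind (- A K) - (\<Sum>J\<in>M - {K}. L J *\<^sub>R ind (A J))"
        by (simp add: sum.remove[OF M(1) K] algebra_simps flip: ind_add_Compl[of "A K"])
      have "ind (- A K) \<in> c0_ideal K"
        using maximal_ideal_Compl[OF M(2)[OF K] A(1)[OF K]]
        by (simp add: ind_in_c0_ideal_iff[OF idl[OF K]])
      then show ?thesis
        unfolding eq
        by (intro Real_Vector_Spaces.subspace_diff[OF sub[OF K]]
            Real_Vector_Spaces.subspace_add[OF sub[OF K]]
            Real_Vector_Spaces.subspace_scale[OF sub[OF K]] L K others)
    qed
    then have "x - (\<Sum>J\<in>M. L J *\<^sub>R ind (A J)) \<in> c0_ideal (\<Inter>M)"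
      by (simp add: c0_ideal_Inter)
    then show ?thesis
      by (rule exI[where x = L])
  qed
  show "vectorspace.fin_dim (class_ring :: real ring) (quotient_vs real_vs (c0_ideal (\<Inter>M)))"
    by (rule dim_quotient_eq_card(1)[where b = "\<lambda>J. ind (A J)", OF W M(1)])
       (erule (1) indep, rule spanning)
  show "vectorspace.dim (class_ring :: real ring) (quotient_vs real_vs (c0_ideal (\<Inter>M))) = card M"
    by (rule dim_quotient_eq_card(2)[where b = "\<lambda>J. ind (A J)", OF W M(1)])
       (erule (1) indep, rule spanning)
qed

section \<open>Disjoint families of sets outside the ideal\<close>

text \<open>As for null ideals in measure theory, a set outside \<open>I\<close> is called positive. The members are
  disjoint in the strict sense, not merely up to sets in \<open>I\<close>, so that indicators can be evaluated
  pointwise.\<close>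

definition positive_family :: "nat set set \<Rightarrow> nat set set \<Rightarrow> bool" where
  "positive_family I F \<longleftrightarrow> finite F \<and> disjoint F \<and> F \<inter> I = {}"

text \<open>On \<open>A \<in> F\<close> a combination of the indicators is constant, equal to the coefficient of \<open>A\<close>. If this
  were nonzero and the combination in \<open>c\<^sub>0(I)\<close>, then \<open>A\<close> would belong to \<open>I\<close>.\<close>

lemma positive_family_card_le_dim:
  assumes I: "nat_ideal I" and F: "positive_family I F"
    and fd: "vectorspace.fin_dim (class_ring :: real ring) (quotient_vs real_vs (c0_ideal I))"
  shows "card F \<le> vectorspace.dim (class_ring :: real ring) (quotient_vs real_vs (c0_ideal I))"
proof (rule card_le_dim_quotient[OF subspace_c0_ideal[OF I] _ _ fd])
  show fin: "finite F"
    using F by (simp add: positive_family_def)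
  fix c A assume c: "(\<Sum>B\<in>F. c B *\<^sub>R ind B) \<in> c0_ideal I" and A: "A \<in> F"
  show "c A = 0"
  proof (rule ccontr)
    assume nz: "c A \<noteq> 0"
    have val: "apply_bcontfun (\<Sum>B\<in>F. c B *\<^sub>R ind B) n = c A" if n: "n \<in> A" for n
    proof -
      have "n \<notin> B" if "B \<in> F - {A}" for B
        using that A n F unfolding positive_family_def by (auto simp: disjoint_def)
      then have "(\<Sum>B\<in>F - {A}. c B * indicator B n) = 0"
        by (intro sum.neutral) simp
      then show ?thesis
        using n by (simp add: apply_bcontfun_sum apply_ind sum.remove[OF fin A])
    qed
    have "{n. \<bar>c A\<bar> \<le> \<bar>apply_bcontfun (\<Sum>B\<in>F. c B *\<^sub>R ind B) n\<bar>} \<in> I"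
      using c nz unfolding c0_ideal_def by simp
    then have "A \<in> I"
      by (rule ideal_subset[OF I]) (auto simp: val)
    then show False
      using A F by (auto simp: positive_family_def)
  qed
qed

text \<open>The set \<open>A\<close> is an atom of the quotient of \<open>\<P>(\<nat>)\<close> by \<open>I\<close>, and the ideal is the one dual to the
  ultrafilter that this atom generates.\<close>

lemma maximal_ideal_of_atom:
  assumes I: "nat_ideal I" and A: "A \<notin> I"
    and atom: "\<And>B. B \<subseteq> A \<Longrightarrow> B \<in> I \<or> A - B \<in> I"
  shows "maximal_nat_ideal {B. B \<inter> A \<in> I}"
proof (rule maximal_nat_idealI)
  show "nat_ideal {B. B \<inter> A \<in> I}"
    by (rule nat_ideal_trace[OF I])
  show "UNIV \<notin> {B. B \<inter> A \<in> I}"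
    using A by simp
  fix B assume "B \<notin> {B. B \<inter> A \<in> I}"
  then have "A - B \<inter> A \<in> I"
    using atom[of "B \<inter> A"] by simp
  also have "A - B \<inter> A = - B \<inter> A"
    by blast
  finally show "- B \<in> {B. B \<inter> A \<in> I}"
    by simp
qed

proposition Inter_maximal_if_bounded:
  assumes I: "nat_ideal I" and bound: "\<And>F. positive_family I F \<Longrightarrow> card F \<le> m"
  shows "\<exists>M. finite M \<and> (\<forall>J\<in>M. maximal_nat_ideal J) \<and> I = \<Inter>M"
proof -
  have "positive_family I {}"
    by (simp add: positive_family_def)
  then have "\<exists>F. positive_family I F \<and> (\<forall>G. positive_family I G \<longrightarrow> card G \<le> card F)"
    by (rule ex_has_greatest_nat[where b = "Suc m"]) (simp add: bound less_Suc_eq_le)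
  then obtain F where F: "positive_family I F"
      and max: "\<And>G. positive_family I G \<Longrightarrow> card G \<le> card F"
    by auto
  have fin: "finite F" and pos: "\<And>A. A \<in> F \<Longrightarrow> A \<notin> I"
      and disj: "\<And>A B. A \<in> F \<Longrightarrow> B \<in> F \<Longrightarrow> A \<noteq> B \<Longrightarrow> A \<inter> B = {}"
    using F by (auto simp: positive_family_def disjoint_def)
  have rest: "- \<Union>F \<in> I"
  proof (rule ccontr)
    assume R: "- \<Union>F \<notin> I"
    then have "- \<Union>F \<notin> F"
      using ideal_empty[OF I] by (cases "- \<Union>F = {}") auto
    moreover have "positive_family I (insert (- \<Union>F) F)"
      using R fin pos disj by (auto simp: positive_family_def disjoint_def)
    ultimately show False
      using max[of "insert (- \<Union>F) F"] fin by simp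
  qed
  have atom: "B \<in> I \<or> A - B \<in> I" if A: "A \<in> F" and B: "B \<subseteq> A" for A B
  proof (rule ccontr)
    assume *: "\<not> ?thesis"
    then have ne: "B \<noteq> {}" "A - B \<noteq> {}"
      using ideal_empty[OF I] by metis+
    have out: "C \<notin> F - {A}" if "C \<subseteq> A" "C \<noteq> {}" for C
      using disj[OF A, of C] that by auto
    define G where "G = insert B (insert (A - B) (F - {A}))"
    have "disjnt C D" if "C \<in> F - {A}" "D \<subseteq> A" for C D
      using disj[OF A, of C] that by (auto simp: disjnt_def)
    then have "disjnt C B" "disjnt C (A - B)" if "C \<in> F - {A}" for C
      using that B by simp_all
    moreover have "disjnt B (A - B)"
      by (simp add: disjnt_def)
    moreover have "disjoint (F - {A})"
      using F by (auto simp: positive_family_def intro: pairwise_subset)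
    ultimately have "disjoint G"
      unfolding G_def by (auto simp: pairwise_insert dest: disjnt_sym)
    moreover have "finite G" and "G \<inter> I = {}"
      using fin pos * by (auto simp: G_def)
    ultimately have "positive_family I G"
      by (simp add: positive_family_def)
    moreover have "card G = Suc (card F)"
    proof -
      have "B \<notin> insert (A - B) (F - {A})" and "A - B \<notin> F - {A}"
        using out[of B] out[of "A - B"] ne B by auto
      then have "card G = Suc (Suc (card (F - {A})))"
        using fin by (simp add: G_def)
      then show ?thesis
        using card_Suc_Diff1[OF fin A] by simp
    qed
    ultimately show False
      using max[of G] by simp
  qed
  define M where "M = (\<lambda>A. {B. B \<inter> A \<in> I}) ` F"
  have "I = \<Inter>M"
  proof (intro equalityI subsetI)
    fix B assume "B \<in> I"
    then have "B \<inter> A \<in> I" for A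
      by (rule ideal_subset[OF I]) simp
    then show "B \<in> \<Inter>M"
      by (simp add: M_def)
  next
    fix B assume "B \<in> \<Inter>M"
    then have "(\<Union>A\<in>F. B \<inter> A) \<in> I"
      using fin by (intro ideal_UN[OF I]) (auto simp: M_def)
    from ideal_Un[OF I this rest] show "B \<in> I"
      by (rule ideal_subset[OF I]) blast
  qed
  moreover have "maximal_nat_ideal J" if "J \<in> M" for J
    using that pos atom by (auto simp: M_def intro!: maximal_ideal_of_atom[OF I])
  moreover have "finite M"
    using fin by (simp add: M_def)
  ultimately show ?thesis
    by (intro exI[of _ M] conjI ballI)
qed

section \<open>The dimension of the quotient by an ideal\<close>

theorem corollary4p7:
  fixes I :: "nat set set" and k :: nat
  assumes "proper_nat_ideal I" and "k > 0"
  shows "(vectorspace.fin_dim (class_ring :: real ring) (quotient_vs real_vs (c0_ideal I)) \<and>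
          vectorspace.dim (class_ring :: real ring) (quotient_vs real_vs (c0_ideal I)) = k)
     \<longleftrightarrow> (\<exists>M. finite M \<and> card M = k \<and> (\<forall>J\<in>M. maximal_nat_ideal J) \<and> I = \<Inter>M)"
    (is "?fd \<and> ?dim = k \<longleftrightarrow> ?rhs")
proof
  assume fd: "?fd \<and> ?dim = k"
  have I: "nat_ideal I"
    using assms(1) by (simp add: proper_nat_ideal_def)
  obtain M where M: "finite M" "\<forall>J\<in>M. maximal_nat_ideal J" "I = \<Inter>M"
    using Inter_maximal_if_bounded[OF I positive_family_card_le_dim[OF I _ conjunct1[OF fd]]]
    by auto
  then have "card M = k"
    using dim_quotient_Inter_maximal(2)[of M] fd by simp
  with M show ?rhs
    by blast
next
  assume ?rhs
  then show "?fd \<and> ?dim = k"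
    using dim_quotient_Inter_maximal by blast
qed

end
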